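(* For all integers $r,k$ with $2\leq r\leq k$, there is a graph $G$ that contains an $r$-simple path of length $k$ and contains no simple path of length greater than $4\log k/\log r$.
   Context: For a graph $G$ (directed, or undirected viewed as directed with both orientations of each edge), a path of length $k$ is a sequence of vertices $v_1,\ldots,v_k$ with $(v_i,v_{i+1})$ an edge for all $i<k$ (vertices may repeat). A path is $r$-simple if every vertex appears in it at most $r$ times; simple means $1$-simple. *)

theory Defs
  imports Complex_Main "Graph_Theory.Graph_Theory"
begin

(* Graph_Theory calls a path with possibly repeated vertices a vwalk (a nonempty list of vertices).
   The length of a path is its number of vertices, i.e. "length p" for the list p;
   vwalk_length counts edges instead and is one smaller.
   Digraphs may have self-loops: a loop (v, v) allows consecutive visits to v. *)

definition r_simple_path :: "nat \<Rightarrow> ('a, 'b) pre_digraph \<Rightarrow> 'a list \<Rightarrow> bool" where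
  "r_simple_path r G p \<longleftrightarrow> vwalk p G \<and> (\<forall>v \<in> verts G. count_list p v \<le> r)"

abbreviation simple_path :: "('a, 'b) pre_digraph \<Rightarrow> 'a list \<Rightarrow> bool" where
  "simple_path \<equiv> r_simple_path 1"

lemma simple_path_iff_vpath: "simple_path G p \<longleftrightarrow> vpath p G"
proof -
  have "distinct p \<longleftrightarrow> (\<forall>v \<in> set p. count_list p v \<le> 1)" for p :: "'a list"
    by (induction p) (auto simp: count_list_0_iff)
  moreover have "count_list p v \<le> 1" if "v \<notin> set p" for v
    using that by (simp add: count_list_0_iff)
  ultimately show ?thesis
    unfolding r_simple_path_def vpath_def vwalk_def by blast
qed

end

theory Submission
  imports Defs "HOL-Library.Countable"
begin

(* The graph is a tree of depth d (vertices are lists of child indices, deepest first) with all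
   loops, in which an inner vertex has r - 1 pairs of children and the two children of a pair are
   adjacent; on the lowest level only one child of each pair is kept. A closed tour that goes
   through each pair as parent, child, sibling, parent passes every vertex exactly r times (using
   the loop at the leaves), and its length is at least r^(d+1). A simple path enters and leaves the
   part below a pair only through the parent of the pair, so it meets at most two such parts on
   each level: it has at most 1 + 4(d - 1) + 2 < 4d vertices. Take d least with k \<le> r^(d+1). *)

section \<open>Tree adjacency and the parts below sibling pairs\<close>

text \<open>The third disjunct covers \<open>x = y\<close> and so supplies the loops. The
  unspecified \<open>hd []\<close> adds no edge: if \<open>tl x = tl y\<close> and one list is
  empty, one of the first two disjuncts holds anyway.\<close>

definition adj :: "nat list \<Rightarrow> nat list \<Rightarrow> bool" where
  "adj x y \<longleftrightarrow> y = tl x \<or> x = tl y \<or> (tl x = tl y \<and> hd x div 2 = hd y div 2)"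

(* The pair through which x hangs below level j: the common parent and the index of the pair.
   Meaningful for 1 \<le> j \<le> length x. *)
definition cluster :: "nat \<Rightarrow> nat list \<Rightarrow> nat list \<times> nat" where
  "cluster j x = (let a = drop (length x - j) x in (tl a, hd a div 2))"

lemma adj_sym: "adj x y \<Longrightarrow> adj y x"
  unfolding adj_def by metis

text \<open>\<open>cluster j\<close> sees only the last \<open>j\<close> entries, the foremost of
  them halved. An edge within levels at least \<open>j\<close> changes at most entries in front of
  these, or swaps two siblings on level \<open>j\<close>, whose halved indices agree.\<close>

lemma cluster_adj:
  assumes "adj x y" "1 \<le> j" "j \<le> length x" "j \<le> length y"
  shows "cluster j y = cluster j x"
proof -
  have ne: "x \<noteq> []" "y \<noteq> []" using assms by auto
  have step: "cluster j (tl u) = cluster j u" if "j \<le> length (tl u)" "u \<noteq> []" for u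
    using that by (cases u) (auto simp: cluster_def Suc_diff_le)
  consider "y = tl x" | "x = tl y" | "tl x = tl y" "hd x div 2 = hd y div 2"
    using assms(1) by (auto simp: adj_def)
  then show ?thesis
  proof cases
    case 1
    then show ?thesis using step[of x] ne assms by simp
  next
    case 2
    then show ?thesis using step[of y] ne assms by simp
  next
    case 3
    obtain a t b where [simp]: "x = a # t" "y = b # t"
      using 3 ne by (metis list.collapse)
    show ?thesis
    proof (cases "j \<le> length t")
      case True
      then show ?thesis using step[of x] step[of y] by simp
    next
      case False
      then have "j = Suc (length t)" using assms by simp
      then show ?thesis using 3 by (simp add: cluster_def)
    qed
  qed
qed

text \<open>An edge changes the level by at most one, so an upward exit starts on level
  \<open>j\<close> itself and leads to the parent.\<close>

lemma cluster_exit: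
  assumes "adj x y" "1 \<le> j" "j \<le> length x" "length y < j"
  shows "y = fst (cluster j x)"
proof -
  obtain a t where x: "x = a # t" using assms by (cases x) auto
  have "y = t \<and> length x = j"
    using assms x by (cases y) (auto simp: adj_def)
  then show ?thesis using x by (auto simp: cluster_def)
qed

text \<open>By \<open>cluster_exit\<close>, the common parent is the only way out of the part below
  a pair.\<close>

lemma walk_trapped_in_cluster:
  assumes "successively adj (x # q)" "1 \<le> j" "j \<le> length x" "fst (cluster j x) \<notin> set q"
  shows "\<forall>y \<in> set (x # q). j \<le> length y \<and> cluster j y = cluster j x"
  using assms
proof (induction q arbitrary: x)
  case Nil
  then show ?case by simp
next
  case (Cons y q)
  have a: "adj x y" using Cons.prems by simp
  have len: "j \<le> length y"
  proof (rule ccontr)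
    assume "\<not> j \<le> length y"
    then have "y = fst (cluster j x)" using cluster_exit[OF a] Cons.prems by simp
    then show False using Cons.prems by simp
  qed
  have eq: "cluster j y = cluster j x" using cluster_adj[OF a] Cons.prems len by simp
  show ?case using Cons.IH[of y] Cons.prems len eq by auto
qed

section \<open>Counting the vertices of a simple path level by level\<close>

lemma length_filter_cluster_le:
  assumes "distinct p" "set p \<subseteq> V" "\<forall>y \<in> set p. cluster j y = c"
    and "finite V" "card {x \<in> V. length x = j \<and> cluster j x = c} \<le> b"
  shows "length (filter (\<lambda>x. length x = j) p) \<le> b"
proof -
  have "length (filter (\<lambda>x. length x = j) p) = card (set (filter (\<lambda>x. length x = j) p))"
    using assms(1) by (metis distinct_card distinct_filter)
  also have "\<dots> \<le> card {x \<in> V. length x = j \<and> cluster j x = c}"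
    using assms by (intro card_mono) auto
  finally show ?thesis using assms(5) by simp
qed

text \<open>The first vertex on level \<open>j\<close> or deeper, if any, is entered from the parent
  of its pair. Distinctness forbids a return to that parent, so the rest of the path is trapped
  below this pair.\<close>

lemma length_filter_from_above:
  assumes "successively adj (x # q)" "distinct (x # q)" "set (x # q) \<subseteq> V" "length x < j"
    and V: "finite V" "1 \<le> j" "\<And>c. card {x \<in> V. length x = j \<and> cluster j x = c} \<le> b"
  shows "length (filter (\<lambda>x. length x = j) (x # q)) \<le> b"
  using assms(1-4)
proof (induction q arbitrary: x)
  case Nil
  then show ?case by simp
next
  case (Cons y q)
  show ?case
  proof (cases "length y < j")
    case True
    then show ?thesis using Cons.IH[of y] Cons.prems by simp
  next
    case False
    have "adj y x" by (rule adj_sym) (use Cons.prems in simp)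
    then have "fst (cluster j y) = x"
      by (rule cluster_exit[symmetric]) (use Cons.prems False V in auto)
    then have "fst (cluster j y) \<notin> set q" using Cons.prems(2) by simp
    moreover have "successively adj (y # q)" using Cons.prems(1) by simp
    ultimately have "\<forall>z \<in> set (y # q). cluster j z = cluster j y"
      using walk_trapped_in_cluster[OF _ V(2) leI[OF False]] by blast
    then have "length (filter (\<lambda>x. length x = j) (y # q)) \<le> b"
      using length_filter_cluster_le[of "y # q" V j "cluster j y" b] Cons.prems V by simp
    then show ?thesis using Cons.prems by simp
  qed
qed

text \<open>The path is cut at its first vertex above level \<open>j\<close>. The piece
  \<open>A\<close> avoids the parent of its first pair, which lies above level \<open>j\<close>, and
  so stays in one cluster; the piece \<open>B\<close> starts above level \<open>j\<close>.\<close>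

lemma length_filter_level:
  assumes p: "successively adj p" "distinct p" "set p \<subseteq> V"
    and V: "finite V" "1 \<le> j" "\<And>c. card {x \<in> V. length x = j \<and> cluster j x = c} \<le> b"
  shows "length (filter (\<lambda>x. length x = j) p) \<le> 2 * b"
proof -
  define A where "A = takeWhile (\<lambda>x. j \<le> length x) p"
  define B where "B = dropWhile (\<lambda>x. j \<le> length x) p"
  have split: "p = A @ B" by (simp add: A_def B_def)
  have deep: "j \<le> length x" if "x \<in> set A" for x
    using that by (auto simp: A_def dest: set_takeWhileD)
  have "length (filter (\<lambda>x. length x = j) A) \<le> b"
  proof (cases A)
    case (Cons x q)
    have jx: "j \<le> length x" using deep Cons by simp
    have "length (fst (cluster j x)) < j"
      using jx V(2) by (simp add: cluster_def Let_def)
    then have "fst (cluster j x) \<notin> set q" using deep[of "fst (cluster j x)"] Cons by auto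
    moreover have "successively adj (x # q)"
      using p(1) split Cons by (auto simp: successively_append_iff simp del: append_Cons)
    ultimately have "\<forall>z \<in> set A. cluster j z = cluster j x"
      unfolding Cons using walk_trapped_in_cluster[OF _ V(2) jx] by blast
    then show ?thesis
      using length_filter_cluster_le[of A V j "cluster j x" b] p split V by simp
  qed simp
  moreover have "length (filter (\<lambda>x. length x = j) B) \<le> b"
  proof (cases B)
    case (Cons x q)
    have "length x < j" using Cons hd_dropWhile[of "\<lambda>x. j \<le> length x" p]
      by (simp add: B_def)
    moreover have "successively adj (x # q)"
      using p(1) split Cons by (simp add: successively_append_iff)
    ultimately show ?thesis
      using length_filter_from_above[of x q V j b] p(2,3) split Cons V by simp
  qed simp
  ultimately show ?thesis by (simp add: split)
qed

lemma list_by_cluster: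
  assumes "1 \<le> j" "length x = j" "cluster j x = (t, m)"
  shows "x = (2 * m) # t \<or> x = Suc (2 * m) # t"
proof (cases x)
  case (Cons a u)
  then have "u = t" "a div 2 = m" using assms by (auto simp: cluster_def)
  moreover from this(2) have "a = 2 * m \<or> a = Suc (2 * m)" by presburger
  ultimately show ?thesis using Cons by blast
qed (use assms in simp)

lemma simple_path_length_le:
  assumes V: "finite V" "\<And>x. x \<in> V \<Longrightarrow> length x \<le> d"
      "\<And>x. x \<in> V \<Longrightarrow> length x = d \<Longrightarrow> even (hd x)" and d: "1 \<le> d"
    and p: "successively adj p" "distinct p" "set p \<subseteq> V"
  shows "length p \<le> 4 * d - 1"
proof -
  let ?n = "\<lambda>j. length (filter (\<lambda>x. length x = j) p)"
  have root: "?n 0 \<le> 1"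
  proof -
    have "?n 0 = card (set (filter (\<lambda>x. length x = 0) p))"
      using p(2) by (metis distinct_card distinct_filter)
    also have "\<dots> \<le> card {[] :: nat list}" by (intro card_mono) auto
    finally show ?thesis by simp
  qed
  have mid: "?n j \<le> 4" if "1 \<le> j" for j
  proof -
    have "card {x \<in> V. length x = j \<and> cluster j x = c} \<le> 2" for c
    proof -
      obtain t m where c: "c = (t, m)" by (cases c)
      have "card {x \<in> V. length x = j \<and> cluster j x = c} \<le> card {(2 * m) # t, Suc (2 * m) # t}"
        using list_by_cluster[OF that] c by (intro card_mono) auto
      then show ?thesis by simp
    qed
    from length_filter_level[OF p V(1) that this] show ?thesis by simp
  qed
  have bottom: "?n d \<le> 2"
  proof -
    have "card {x \<in> V. length x = d \<and> cluster d x = c} \<le> 1" for c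
    proof -
      obtain t m where c: "c = (t, m)" by (cases c)
      have "x = (2 * m) # t" if "x \<in> V" "length x = d" "cluster d x = c" for x
        using list_by_cluster[OF d that(2)] that(3) c V(3)[OF that(1,2)] by auto
      then have "card {x \<in> V. length x = d \<and> cluster d x = c} \<le> card {(2 * m) # t}"
        by (intro card_mono) auto
      then show ?thesis by simp
    qed
    from length_filter_level[OF p V(1) d this] show ?thesis by simp
  qed
  have "length p = sum (count_list (map length p)) {..d}"
    using V(2) p(3) by (subst sum_count_set) auto
  also have "\<dots> = (\<Sum>j\<le>d. ?n j)"
    by (intro sum.cong refl)
      (simp add: count_list_eq_length_filter filter_map comp_def eq_commute)
  \<comment> \<open>Levels 0 and \<open>d\<close> are distinct as \<open>1 \<le> d\<close>, so the
    total is at most \<open>1 + 2 + 4 * (d - 1)\<close>.\<close>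
  also have "{..d} = insert 0 (insert d {1..<d})" using d by auto
  also have "(\<Sum>j\<in>\<dots>. ?n j) = ?n 0 + ?n d + (\<Sum>j\<in>{1..<d}. ?n j)" using d by simp
  also have "(\<Sum>j\<in>{1..<d}. ?n j) \<le> (\<Sum>j\<in>{1..<d}. 4)" using mid by (intro sum_mono) simp
  finally show ?thesis using root bottom d by simp
qed

section \<open>The closed tour of the tree\<close>

text \<open>\<open>h\<close> is the height of the subtree at \<open>x\<close>. In the second
  equation, \<open>h = 0\<close> means that the children are leaves, of which only the even ones are
  kept.\<close>

fun tour :: "nat \<Rightarrow> nat \<Rightarrow> nat list \<Rightarrow> nat list list" where
  "tour r 0 x = replicate r x"
| "tour r (Suc h) x = x # concat (map (\<lambda>i. (tour r h ((2 * i) # x) @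
     (if h = 0 then [] else tour r h (Suc (2 * i) # x))) @ [x]) [0..<r - 1])"

text \<open>The parity clause records that each pair on the lowest level keeps one child, as
  \<open>simple_path_length_le\<close> requires.\<close>

lemma tour_below:
  assumes "y \<in> set (tour r h x)"
  shows "\<exists>zs. y = zs @ x \<and> length zs \<le> h \<and> (0 < h \<longrightarrow> length zs = h \<longrightarrow> even (hd zs))"
  using assms
proof (induction h arbitrary: x)
  case 0
  then show ?case by simp
next
  case (Suc h)
  \<comment> \<open>For \<open>h = 0\<close> the inner \<open>zs\<close> is empty, so
    \<open>c\<close> becomes the head whose parity matters.\<close>
  have sub: ?case if mem: "y \<in> set (tour r h (c # x))" and c: "h = 0 \<longrightarrow> even c" for c
  proof -
    obtain zs where "y = zs @ c # x" "length zs \<le> h" "0 < h \<longrightarrow> length zs = h \<longrightarrow> even (hd zs)"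
      using Suc.IH[OF mem] by blast
    then show ?thesis using c
      by (intro exI[of _ "zs @ [c]"]) (cases zs; auto)
  qed
  consider "y = x" | i where "y \<in> set (tour r h ((2 * i) # x))"
    | i where "h \<noteq> 0" "y \<in> set (tour r h (Suc (2 * i) # x))"
    using Suc.prems by (auto split: if_splits)
  then show ?case
  proof cases
    case 1
    then show ?thesis by simp
  qed (use sub in auto)
qed

lemma last_excursions: "last (x # concat (map (\<lambda>i. f i @ [x]) [0..<n])) = x"
  by (induction n) auto

text \<open>Excursions can be chained because each ends at the \<open>x\<close> from which the next
  one starts.\<close>

lemma successively_excursions:
  assumes "\<And>i. i < n \<Longrightarrow> successively P (x # f i @ [x])"
  shows "successively P (x # concat (map (\<lambda>i. f i @ [x]) [0..<n]))"
  using assms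
proof (induction n)
  case (Suc n)
  define w where "w = x # concat (map (\<lambda>i. f i @ [x]) [0..<n])"
  have w: "successively P w" "last w = x"
    using Suc last_excursions[of x f n] by (auto simp: w_def)
  have "successively P (x # f n @ [x])" using Suc.prems by simp
  then have "successively P (w @ (f n @ [x]))"
    using w by (simp only: successively_append_iff[of P w] successively_Cons[of P x]) auto
  then show ?case by (simp add: w_def)
qed simp

lemma tour_ends:
  assumes "0 < r"
  shows "tour r h x \<noteq> []" "hd (tour r h x) = x" "last (tour r h x) = x"
proof -
  show "tour r h x \<noteq> []" "hd (tour r h x) = x"
    using assms by (cases h; simp)+
  show "last (tour r h x) = x"
    using assms by (cases h) (simp, simp only: tour.simps last_excursions)
qed

lemma successively_tour:
  assumes "0 < r"
  shows "successively adj (tour r h x)"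
proof (induction h arbitrary: x)
  case 0
  have "adj x x" by (simp add: adj_def)
  then have "successively adj (replicate n x)" for n
  proof (induction n)
    case (Suc n)
    then show ?case by (cases n) simp_all
  qed simp
  then show ?case by simp
next
  case (Suc h)
  have "adj x (c # x)" "adj (c # x) x" "adj ((2 * i) # x) (Suc (2 * i) # x)" for c i
    by (auto simp: adj_def)
  then show ?case
    unfolding tour.simps
    by (intro successively_excursions)
      (auto simp: Suc.IH successively_append_iff successively_Cons tour_ends[OF assms] hd_append)
qed

lemma count_list_concat_map_upt:
  "count_list (concat (map f [0..<n])) y = (\<Sum>i<n. count_list (f i) y)"
  by (induction n) auto

text \<open>\<open>x\<close> is met at the start and after each of the \<open>r - 1\<close>
  excursions. Any other vertex lies below at most one child of \<open>x\<close>, so at most one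
  subtour meets it.\<close>

lemma count_list_tour_le:
  assumes "0 < r"
  shows "count_list (tour r h x) y \<le> r"
proof (induction h arbitrary: x)
  case 0
  show ?case using count_le_length[of "replicate r x" y] by simp
next
  case (Suc h)
  let ?f = "\<lambda>i. tour r h ((2 * i) # x) @ (if h = 0 then [] else tour r h (Suc (2 * i) # x))"
  have count: "count_list (tour r (Suc h) x) y =
    (if x = y then 1 else 0) + (\<Sum>i<r - 1. count_list (?f i) y + (if x = y then 1 else 0))"
    by (auto simp: count_list_concat_map_upt)
  show ?case
  proof (cases "x = y")
    case True
    have "y \<notin> set (tour r h (c # x))" for c
      using tour_below[of y r h "c # x"] True by auto
    then have "count_list (?f i) y = 0" for i by simp
    then show ?thesis using count True assms by simp
  next
    case False
    \<comment> \<open>If \<open>y\<close> lies properly below \<open>x\<close>, this is the entry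
      just in front of the suffix \<open>x\<close>, hence the child of \<open>x\<close> that leads
      to \<open>y\<close>.\<close>
    define c where "c = y ! (length y - Suc (length x))"
    have out: "count_list (tour r h (b # x)) y = 0" if "b \<noteq> c" for b
      using tour_below[of y r h "b # x"] that by (auto simp: c_def count_list_0_iff)
    have "count_list (?f i) y \<le> (if i = c div 2 then r else 0)" for i
    proof -
      consider "c \<noteq> 2 * i" "c \<noteq> Suc (2 * i)" | "c = 2 * i" | "c = Suc (2 * i)" by blast
      then show ?thesis
      proof cases
        case 1
        then show ?thesis by (simp add: out)
      qed (use out[of "2 * i"] out[of "Suc (2 * i)"] Suc.IH in auto)
    qed
    then have "(\<Sum>i<r - 1. count_list (?f i) y) \<le> (\<Sum>i<r - 1. if i = c div 2 then r else 0)"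
      by (rule sum_mono)
    also have "\<dots> \<le> r" by simp
    finally show ?thesis unfolding count using False by (simp only: if_False add_0_left add_0_right)
  qed
qed

lemma length_concat_map_upt_ge:
  assumes "\<And>i. m \<le> length (f i)"
  shows "n * m \<le> length (concat (map f [0..<n]))"
proof (induction n)
  case (Suc n)
  then show ?case using add_mono[OF Suc.IH assms[of n]] by simp
qed simp

text \<open>Two subtours per excursion give the factor \<open>2 * (r - 1) \<ge> r\<close>. Just
  above the leaves one subtour suffices: with the returns to \<open>x\<close>, the length is
  \<open>(r - 1) * (r + 1) + 1 = r ^ 2\<close>.\<close>

lemma length_tour_ge:
  assumes "2 \<le> r"
  shows "r ^ Suc h \<le> length (tour r h x)"
proof (induction h arbitrary: x)
  case 0
  show ?case by simp
next
  case (Suc h)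
  obtain s where r: "r = 2 + s" using le_Suc_ex[OF assms] by blast
  let ?m = "(if h = 0 then r else 2 * r ^ Suc h) + 1"
  let ?f = "\<lambda>i. (tour r h ((2 * i) # x) @
     (if h = 0 then [] else tour r h (Suc (2 * i) # x))) @ [x]"
  have "?m \<le> length (?f i)" for i
  proof (cases "h = 0")
    case False
    then show ?thesis
      using add_mono[OF Suc.IH[of "(2 * i) # x"] Suc.IH[of "Suc (2 * i) # x"]]
      by (simp only: if_False length_append list.size mult_2)
  qed simp
  then have "(r - 1) * ?m \<le> length (concat (map ?f [0..<r - 1]))"
    by (rule length_concat_map_upt_ge[of ?m ?f])
  then have "Suc ((r - 1) * ?m) \<le> length (tour r (Suc h) x)"
    by (simp only: tour.simps list.size Suc_le_mono add_Suc_right add_0_right)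
  moreover have "r ^ Suc (Suc h) \<le> Suc ((r - 1) * ?m)"
  proof (cases "h = 0")
    case True
    then show ?thesis by (simp add: r)
  next
    case False
    have "r * r ^ Suc h \<le> (2 * (r - 1)) * r ^ Suc h"
      by (rule mult_right_mono) (use assms in auto)
    also have "\<dots> = (r - 1) * (2 * r ^ Suc h)" by (simp only: mult.commute mult.left_commute)
    also have "\<dots> \<le> (r - 1) * ?m" by (rule mult_left_mono) (use False in auto)
    finally show ?thesis by (simp only: power_Suc le_SucI)
  qed
  ultimately show ?case by (rule order.trans[rotated])
qed

lemma vwalk_arcs_subset_iff: "set (vwalk_arcs p) \<subseteq> A \<longleftrightarrow> successively (\<lambda>x y. (x, y) \<in> A) p"
  by (induction p rule: vwalk_arcs.induct) auto

section \<open>Choice of the depth and transfer to natural numbers as vertices\<close>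

theorem theorem4:
  fixes r k :: nat
  assumes "2 \<le> r" and "r \<le> k"
  shows "\<exists>G :: nat pair_pre_digraph. pair_fin_digraph G \<and>
    (\<exists>p. r_simple_path r (with_proj G) p \<and> length p = k) \<and>
    \<not> (\<exists>p. simple_path (with_proj G) p \<and> real (length p) > 4 * ln (real k) / ln (real r))"
proof -
  \<comment> \<open>Minimality gives \<open>r ^ d \<le> k \<le> r ^ Suc d\<close>: the right part
    makes the tour long enough, the left part bounds \<open>d\<close> by
    \<open>ln k / ln r\<close>.\<close>
  define d where "d = (LEAST d. k \<le> r ^ Suc d)"
  have "k \<le> r ^ Suc k"
    using assms less_exp[of "Suc k"] power_mono[of 2 r "Suc k"] by linarith
  then have kd: "k \<le> r ^ Suc d" unfolding d_def by (rule LeastI)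
  have dk: "r ^ d \<le> k"
  proof (cases d)
    case (Suc e)
    then have "\<not> k \<le> r ^ Suc e" unfolding d_def by (intro not_less_Least) simp
    then show ?thesis using Suc by simp
  qed (use assms in simp)
  have lnr: "ln (real r) > 0" using assms by simp
  have "real d * ln (real r) = ln (real (r ^ d))" using assms by (simp add: ln_realpow)
  also have "\<dots> \<le> ln (real k)" using dk assms
    by (subst ln_le_cancel_iff) (auto simp del: of_nat_power)
  finally have bound: "4 * real d \<le> 4 * ln (real k) / ln (real r)"
    using lnr by (simp add: field_simps)
  define V where "V = set (tour r d [])"
  have V: "finite V" "length x \<le> d" "0 < d \<Longrightarrow> length x = d \<Longrightarrow> even (hd x)" if "x \<in> V" for x
    using tour_below[of x r d "[]"] that by (auto simp: V_def)
  \<comment> \<open>Injectivity of \<open>to_nat\<close> carries walks and multiplicities over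
    between lists and naturals.\<close>
  define G where "G = \<lparr>pverts = to_nat ` V,
    parcs = {(to_nat x, to_nat y) | x y. x \<in> V \<and> y \<in> V \<and> adj x y}\<rparr>"
  have arcs: "parcs G \<subseteq> pverts G \<times> pverts G" by (auto simp: G_def)
  have fin: "finite (pverts G)" by (simp add: G_def V_def)
  have G: "pair_fin_digraph G"
    by unfold_locales (use arcs fin in \<open>auto intro: finite_subset\<close>)
  \<comment> \<open>An initial segment of the tour has length exactly \<open>k\<close> and visits no
    vertex more often than the tour does.\<close>
  define p where "p = take k (tour r d [])"
  have lenp: "length p = k"
    using kd length_tour_ge[OF assms(1), of d "[]"] by (simp add: p_def)
  have pV: "set p \<subseteq> V" by (auto simp: p_def V_def dest: in_set_takeD)
  have "successively adj p"
    using successively_tour[of r d "[]"] assms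
      successively_append_iff[of adj p "drop k (tour r d [])"] by (simp add: p_def)
  then have "successively (\<lambda>x y. (to_nat x, to_nat y) \<in> parcs G) p"
    by (rule successively_mono) (use pV in \<open>auto simp: G_def\<close>)
  then have walk: "vwalk (map to_nat p) (with_proj G)"
    using pV lenp assms
    by (auto simp: vwalk_def vwalk_arcs_subset_iff successively_map G_def)
  have "count_list p x \<le> r" for x
  proof -
    have "count_list (tour r d []) x = count_list p x + count_list (drop k (tour r d [])) x"
      by (metis append_take_drop_id count_list_append p_def)
    then show ?thesis using count_list_tour_le[of r d "[]" x] assms by simp
  qed
  then have "r_simple_path r (with_proj G) (map to_nat p)"
    using walk by (auto simp: r_simple_path_def G_def count_list_map_conv)
  then have "\<exists>p. r_simple_path r (with_proj G) p \<and> length p = k"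
    using lenp by (intro exI[of _ "map to_nat p"]) simp
  moreover have "real (length q) \<le> 4 * ln (real k) / ln (real r)"
    if "simple_path (with_proj G) q" for q
  proof -
    have q: "vwalk q (with_proj G)" "distinct q"
      using that unfolding simple_path_iff_vpath vpath_def by auto
    then have "q \<in> lists (to_nat ` V)" by (auto simp: vwalk_def G_def)
    then obtain s where s: "q = map to_nat s" "set s \<subseteq> V"
      unfolding lists_image by auto
    have "successively (\<lambda>x y. (to_nat x, to_nat y) \<in> parcs G) s"
      using q(1) s by (simp add: vwalk_def vwalk_arcs_subset_iff successively_map)
    then have adj: "successively adj s"
      by (rule successively_mono) (auto simp: G_def)
    have dist: "distinct s" using q(2) s by (simp add: distinct_map)
    show ?thesis
    \<comment> \<open>For \<open>d = 0\<close> root and lowest level coincide, so the level count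
      does not apply. The graph is then one vertex with a loop, while \<open>r \<le> k\<close> makes
      the bound at least 4.\<close>
    proof (cases "d = 0")
      case True
      have "length s = card (set s)" using dist by (simp add: distinct_card)
      also have "\<dots> \<le> card {[] :: nat list}"
        using V(2) s True by (intro card_mono) auto
      finally have "length q \<le> 1" using s by simp
      moreover have "ln (real r) \<le> ln (real k)" using assms by simp
      then have "4 \<le> 4 * ln (real k) / ln (real r)" using lnr by (simp add: field_simps)
      ultimately show ?thesis by linarith
    next
      case False
      have "length s \<le> 4 * d - 1"
        using simple_path_length_le[of V d s] V False adj dist s by (auto simp: V_def)
      then have "real (length q) \<le> 4 * real d" using s by simp
      then show ?thesis using bound by simp
    qed
  qed
  ultimately show ?thesis using G by (intro exI[of _ G]) (auto simp: not_less)
qed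

end
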